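(* Let $a,b,c\in\mathbb{R}$ with $a>0$, $c>0$ and $b^{2}-4ac<0$, and let $\Omega=\{(x_1,x_2)\in\mathbb{R}^2 : ax_{1}^{2}+bx_{1}x_{2}+cx_{2}^{2}<1\}$. Then the equation $$(Z_{11}Q)\,Q=Q \quad\text{in } \Omega$$ has a constant solution, namely $Q=1+\frac{c}{a}$.
   Context: For a bounded domain $\Omega\subset\mathbb{R}^2$ and a function $f$ on $\Omega$, $\Delta^{-1}f$ denotes the solution $\psi$ of the Dirichlet problem $\Delta\psi=f$ in $\Omega$, $\psi|_{\partial\Omega}=0$ (homogeneous Dirichlet boundary condition). The operator $Z_{ij}$ is defined by $Z_{ij}f=\partial_{x_i}\partial_{x_j}\Delta^{-1}f$ on $\Omega$; in particular $Z_{11}=\partial_{x_1}^2\Delta^{-1}$. The product $(Z_{11}Q)\,Q$ is the pointwise product of functions on $\Omega$. *)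

theory Defs
  imports "HOL-Analysis.Analysis"
begin

definition partial_deriv :: "'n::finite \<Rightarrow> (real^'n \<Rightarrow> real) \<Rightarrow> real^'n \<Rightarrow> real" where
  "partial_deriv i f x = frechet_derivative f (at x) (axis i 1)"

text \<open>The following two notions are meant for open sets, where they agree with the usual
  spaces of once and twice continuously differentiable functions.\<close>

definition C1_on :: "(real^'n::finite) set \<Rightarrow> (real^'n \<Rightarrow> real) \<Rightarrow> bool" where
  "C1_on S f \<longleftrightarrow>
     (\<forall>x\<in>S. f differentiable (at x)) \<and> (\<forall>i. continuous_on S (partial_deriv i f))"

definition C2_on :: "(real^'n::finite) set \<Rightarrow> (real^'n \<Rightarrow> real) \<Rightarrow> bool" where
  "C2_on S f \<longleftrightarrow> C1_on S f \<and> (\<forall>i. C1_on S (partial_deriv i f))"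

definition laplacian :: "(real^'n::finite \<Rightarrow> real) \<Rightarrow> real^'n \<Rightarrow> real" where
  "laplacian f x = (\<Sum>i\<in>UNIV. partial_deriv i (partial_deriv i f) x)"

text \<open>Classical solutions. A function on the closure of \<open>\<Omega>\<close> is represented by its extension by
  zero to the whole space, so that uniqueness of the solution is uniqueness of a total function.\<close>

definition dirichlet_solution ::
    "(real^'n::finite) set \<Rightarrow> (real^'n \<Rightarrow> real) \<Rightarrow> (real^'n \<Rightarrow> real) \<Rightarrow> bool" where
  "dirichlet_solution \<Omega> f \<psi> \<longleftrightarrow>
     C2_on \<Omega> \<psi> \<and> continuous_on (closure \<Omega>) \<psi> \<and>
     (\<forall>x\<in>\<Omega>. laplacian \<psi> x = f x) \<and>
     (\<forall>x\<in>frontier \<Omega>. \<psi> x = 0) \<and>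
     (\<forall>x. x \<notin> closure \<Omega> \<longrightarrow> \<psi> x = 0)"

definition inv_laplacian ::
    "(real^'n::finite) set \<Rightarrow> (real^'n \<Rightarrow> real) \<Rightarrow> real^'n \<Rightarrow> real" where
  "inv_laplacian \<Omega> f = (THE \<psi>. dirichlet_solution \<Omega> f \<psi>)"

definition Z_op ::
    "(real^'n::finite) set \<Rightarrow> 'n \<Rightarrow> 'n \<Rightarrow> (real^'n \<Rightarrow> real) \<Rightarrow> real^'n \<Rightarrow> real" where
  "Z_op \<Omega> i j f = partial_deriv i (partial_deriv j (inv_laplacian \<Omega> f))"

text \<open>The equation \<open>(Z\<^sub>1\<^sub>1 Q) Q = Q\<close> in \<open>\<Omega>\<close>. The first conjunct says that the inverse Laplacian of
  \<open>Q\<close> is well defined, so that the description operator in \<open>inv_laplacian\<close> denotes it.\<close>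

definition solves_Z11_equation :: "(real^2) set \<Rightarrow> (real^2 \<Rightarrow> real) \<Rightarrow> bool" where
  "solves_Z11_equation \<Omega> Q \<longleftrightarrow>
     (\<exists>!\<psi>. dirichlet_solution \<Omega> Q \<psi>) \<and>
     (\<forall>x\<in>\<Omega>. Z_op \<Omega> 1 1 Q x * Q x = Q x)"

end

theory Submission
  imports Defs
begin

text \<open>If \<open>q\<close> is the quadratic form defining the ellipse \<open>\<Omega>\<close>, then \<open>(q - 1) / (2 * a)\<close> vanishes on
  the boundary, has second \<open>x\<^sub>1\<close>-derivative \<open>1\<close> and Laplacian \<open>1 + c / a\<close>. It is the only
  solution of the Dirichlet problem by the weak maximum principle: after adding a small multiple of
  \<open>\<parallel>x\<parallel>\<^sup>2\<close> to the difference of two solutions, some second partial derivative at an interior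
  maximum would be positive.\<close>

section \<open>Partial derivatives\<close>

lemma partial_deriv_eq:
  assumes "(f has_derivative f') (at x)"
  shows "partial_deriv i f x = f' (axis i 1)"
  using frechet_derivative_at[OF assms] by (simp add: partial_deriv_def)

text \<open>Differentiation is local. This matters because \<open>\<psi>\<close> and its partial
  derivatives are given by formulas on \<open>\<Omega>\<close> only.\<close>

lemma has_derivative_agree_on_open:
  assumes "(g has_derivative g') (at x)" "open S" "x \<in> S" "\<And>y. y \<in> S \<Longrightarrow> f y = g y"
  shows "(f has_derivative g') (at x)"
  using assms by (auto intro: has_derivative_transform_within_open)

lemma has_derivative_vec_nth: "((\<lambda>x. x $ i) has_derivative (\<lambda>h. h $ i)) F"
  for i :: "'n::finite" and F :: "(real^'n) filter"
  using bounded_linear_vec_nth by (rule bounded_linear_imp_has_derivative)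

text \<open>Chain rule along a coordinate line; used for a function and again for its partial
  derivative, it reduces second partials to one-variable calculus.\<close>

lemma has_real_derivative_along_axis:
  fixes f :: "real^'n \<Rightarrow> real"
  assumes "f differentiable (at (x + t *\<^sub>R axis i 1))"
  shows "((\<lambda>s. f (x + s *\<^sub>R axis i 1)) has_real_derivative
           partial_deriv i f (x + t *\<^sub>R axis i 1)) (at t)"
proof -
  let ?y = "x + t *\<^sub>R axis i 1" and ?f' = "frechet_derivative f (at (x + t *\<^sub>R axis i 1))"
  have f: "(f has_derivative ?f') (at ?y)"
    using assms frechet_derivative_works by blast
  have "((\<lambda>s. x + s *\<^sub>R axis i 1) has_derivative (\<lambda>s. s *\<^sub>R axis i 1)) (at t)"
    by (auto intro!: derivative_eq_intros)
  from has_derivative_compose[OF this f]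
  have "((\<lambda>s. f (x + s *\<^sub>R axis i 1)) has_derivative (\<lambda>s. ?f' (s *\<^sub>R axis i 1))) (at t)" .
  moreover have "?f' (s *\<^sub>R axis i 1) = partial_deriv i f ?y * s" for s
    using linear_scale[OF has_derivative_linear[OF f]] by (simp add: partial_deriv_def)
  ultimately show ?thesis
    by (simp add: has_field_derivative_def)
qed

section \<open>Comparison principle\<close>

text \<open>At the maximum \<open>g'\<close> vanishes; since \<open>l > 0\<close>, it is positive
  just to the right of 0, so by the mean value theorem \<open>g\<close> exceeds \<open>g 0\<close>
  there.\<close>

lemma no_local_max_if_second_deriv_pos:
  fixes g g' :: "real \<Rightarrow> real"
  assumes "\<delta> > 0"
    and g: "\<And>t. \<bar>t\<bar> < \<delta> \<Longrightarrow> (g has_real_derivative g' t) (at t)"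
    and g': "(g' has_real_derivative l) (at 0)" and "l > 0"
    and max: "\<And>t. \<bar>t\<bar> < \<delta> \<Longrightarrow> g t \<le> g 0"
  shows False
proof -
  have g'0: "g' 0 = 0"
    using DERIV_local_max[OF g[of 0] \<open>\<delta> > 0\<close>] max \<open>\<delta> > 0\<close> by simp
  obtain d where d: "d > 0" "\<And>h. 0 < h \<Longrightarrow> h < d \<Longrightarrow> g' h > 0"
    using DERIV_pos_inc_right[OF g' \<open>l > 0\<close>] g'0 by auto
  define t where "t = min d \<delta> / 2"
  have t: "0 < t" "t < d" "t < \<delta>"
    using d \<open>\<delta> > 0\<close> by (auto simp: t_def min_def)
  obtain z where z: "0 < z" "z < t" "g t - g 0 = (t - 0) * g' z"
    using MVT2[of 0 t g g'] g t by fastforce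
  have "g t - g 0 > 0"
    using z t d by simp
  with max[of t] t show False by simp
qed

lemma laplacian_comparison:
  fixes f g :: "real^'n \<Rightarrow> real"
  assumes "open S" "bounded S"
    and C2: "C2_on S f" "C2_on S g"
    and cont: "continuous_on (closure S) f" "continuous_on (closure S) g"
    and lap: "\<And>x. x \<in> S \<Longrightarrow> laplacian g x \<le> laplacian f x"
    and bd: "\<And>x. x \<in> frontier S \<Longrightarrow> f x \<le> g x"
    and "x \<in> S"
  shows "f x \<le> g x"
proof (rule ccontr)
  assume "\<not> f x \<le> g x"
  define d where "d = f x - g x"
  have "d > 0" using \<open>\<not> f x \<le> g x\<close> by (simp add: d_def)
  obtain R where R: "\<And>y. y \<in> closure S \<Longrightarrow> norm y \<le> R"
    using bounded_closure[OF \<open>bounded S\<close>] unfolding bounded_iff by blast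
  \<comment> \<open>Small enough that \<open>\<epsilon> * (y \<bullet> y)\<close> stays below
    \<open>d\<close> on the closure; the summand 1 makes this strict and keeps the denominator
    positive.\<close>
  define \<epsilon> where "\<epsilon> = d / (R\<^sup>2 + 1)"
  have R1: "R\<^sup>2 + 1 > 0"
    by (smt (verit) zero_le_power2)
  have "\<epsilon> > 0" using \<open>d > 0\<close> R1 by (simp add: \<epsilon>_def)
  have "\<epsilon> * (R\<^sup>2 + 1) = d"
    using R1 by (simp add: \<epsilon>_def)
  then have \<epsilon>R: "\<epsilon> * R\<^sup>2 < d"
    using \<open>\<epsilon> > 0\<close> by (simp add: algebra_simps)
  define v where "v y = f y - g y + \<epsilon> * (y \<bullet> y)" for y
  have "continuous_on (closure S) v"
    unfolding v_def by (intro continuous_intros cont)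
  moreover have "x \<in> closure S"
    using \<open>x \<in> S\<close> closure_subset by blast
  moreover have "compact (closure S)"
    using \<open>bounded S\<close> by (simp add: compact_closure)
  ultimately obtain p where p: "p \<in> closure S" "\<And>y. y \<in> closure S \<Longrightarrow> v y \<le> v p"
    by (metis continuous_attains_sup empty_iff)
  have "\<epsilon> * (x \<bullet> x) \<ge> 0"
    using \<open>\<epsilon> > 0\<close> by simp
  with p(2)[OF \<open>x \<in> closure S\<close>] have "v p \<ge> d"
    unfolding v_def d_def by linarith
  \<comment> \<open>On the boundary \<open>v\<close> is at most
    \<open>\<epsilon> * R\<^sup>2 < d\<close>, whereas \<open>v p \<ge> v x \<ge> d\<close>.\<close>
  have "p \<in> S"
  proof (rule ccontr)
    assume "p \<notin> S"
    then have "f p \<le> g p"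
      using p(1) bd \<open>open S\<close> by (simp add: frontier_def interior_open)
    moreover have "p \<bullet> p \<le> R\<^sup>2"
      using R[OF p(1)] by (simp add: dot_square_norm power_mono)
    then have "\<epsilon> * (p \<bullet> p) \<le> \<epsilon> * R\<^sup>2"
      using \<open>\<epsilon> > 0\<close> by simp
    ultimately show False
      using \<open>v p \<ge> d\<close> \<epsilon>R by (simp add: v_def)
  qed
  \<comment> \<open>The sum is the Laplacian of \<open>v\<close> at \<open>p\<close>: each direction
    gains \<open>2 * \<epsilon>\<close> from the quadratic term. Some summand must then be positive,
    which singles out the direction \<open>i\<close>.\<close>
  have "(\<Sum>i\<in>UNIV. partial_deriv i (partial_deriv i f) p
          - partial_deriv i (partial_deriv i g) p + 2 * \<epsilon>) > 0"
    using lap[OF \<open>p \<in> S\<close>] \<open>\<epsilon> > 0\<close>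
    by (simp add: laplacian_def sum.distrib sum_subtractf add_nonneg_pos)
  then obtain i where
    i: "partial_deriv i (partial_deriv i f) p - partial_deriv i (partial_deriv i g) p + 2 * \<epsilon> > 0"
    by (meson not_le sum_nonpos)
  obtain \<delta> where \<delta>: "\<delta> > 0" "ball p \<delta> \<subseteq> S"
    using \<open>open S\<close> \<open>p \<in> S\<close> open_contains_ball by blast
  define l where "l t = p + t *\<^sub>R axis i (1::real)" for t
  have l: "l t \<in> S" if "\<bar>t\<bar> < \<delta>" for t
    using that \<delta>(2) by (auto simp: l_def dist_norm norm_axis_1)
  have diff: "h differentiable (at y)" "partial_deriv i h differentiable (at y)"
    if "C2_on S h" "y \<in> S" for h y
    using that by (auto simp: C2_on_def C1_on_def)
  \<comment> \<open>On the line the perturbation is a polynomial in \<open>t\<close>, with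
    derivative \<open>2 * p $ i + 2 * t\<close>.\<close>
  have quad: "l t \<bullet> l t = p \<bullet> p + 2 * t * p $ i + t\<^sup>2" for t
    by (simp add: l_def inner_add_left inner_add_right inner_axis inner_axis' power2_eq_square
        algebra_simps)
  have along: "((\<lambda>s. h (l s)) has_real_derivative partial_deriv i h (l t)) (at t)"
    if "h differentiable (at (l t))" for h t
    using has_real_derivative_along_axis that unfolding l_def by blast
  show False
  proof (rule no_local_max_if_second_deriv_pos[OF \<delta>(1) _ _ i])
    show "((\<lambda>t. v (l t)) has_real_derivative
        partial_deriv i f (l t) - partial_deriv i g (l t) + \<epsilon> * (2 * p $ i + 2 * t)) (at t)"
      if "\<bar>t\<bar> < \<delta>" for t
      unfolding v_def quad
      by (auto intro!: derivative_eq_intros along diff C2 l that)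
    have l0: "l 0 = p" by (simp add: l_def)
    show "((\<lambda>t. partial_deriv i f (l t) - partial_deriv i g (l t) + \<epsilon> * (2 * p $ i + 2 * t))
        has_real_derivative partial_deriv i (partial_deriv i f) p
          - partial_deriv i (partial_deriv i g) p + 2 * \<epsilon>) (at 0)"
      using along[of "partial_deriv i f" 0] along[of "partial_deriv i g" 0] diff C2 \<open>p \<in> S\<close>
      by (auto intro!: derivative_eq_intros simp: l0)
    show "v (l t) \<le> v (l 0)" if "\<bar>t\<bar> < \<delta>" for t
      using p(2) l[OF that] closure_subset l0 by auto
  qed
qed

text \<open>Equal Laplacians and boundary values allow comparison in both directions on
  \<open>S\<close>; elsewhere both functions are zero by the extension convention.\<close>

lemma dirichlet_solution_unique:
  assumes "open S" "bounded S" "dirichlet_solution S f \<phi>" "dirichlet_solution S f \<psi>"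
  shows "\<phi> = \<psi>"
proof
  fix x
  have le: "u x \<le> w x" if "dirichlet_solution S f u" "dirichlet_solution S f w" "x \<in> S" for u w
    by (rule laplacian_comparison[OF assms(1,2)]) (use that in \<open>auto simp: dirichlet_solution_def\<close>)
  show "\<phi> x = \<psi> x"
  proof (cases "x \<in> S")
    case True
    with le assms(3,4) show ?thesis by (meson order_antisym)
  next
    case False
    then have "x \<in> frontier S \<or> x \<notin> closure S"
      using assms(1) by (auto simp: frontier_def interior_open)
    with assms(3,4) show ?thesis by (auto simp: dirichlet_solution_def)
  qed
qed

section \<open>The ellipse\<close>

text \<open>Completing the square in one variable bounds the other, because \<open>D\<close>, the
  negated discriminant, is positive.\<close>

lemma ellipse_bounded:
  fixes a b c :: real
  assumes "a > 0" "c > 0" "b\<^sup>2 - 4 * a * c < 0"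
  shows "bounded {x :: real^2. a * (x $ 1)\<^sup>2 + b * (x $ 1) * (x $ 2) + c * (x $ 2)\<^sup>2 < 1}"
proof -
  define D where "D = 4 * a * c - b\<^sup>2"
  have "D > 0" using assms by (simp add: D_def)
  have le: "\<bar>z\<bar> \<le> 4 * k / D + 1"
    if "k > 0" "D * z\<^sup>2 \<le> 4 * k" for k z :: real
  proof -
    have "z\<^sup>2 \<le> 4 * k / D"
      using that \<open>D > 0\<close> by (simp add: field_simps)
    \<comment> \<open>A crude bound that avoids square roots.\<close>
    moreover have "\<bar>z\<bar> \<le> z\<^sup>2 + 1"
      using zero_le_power2[of "\<bar>z\<bar> - 1"] by (simp add: power2_eq_square algebra_simps)
    ultimately show ?thesis by linarith
  qed
  show ?thesis
    unfolding bounded_iff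
  proof (intro exI ballI)
    fix x :: "real^2"
    let ?q = "a * (x $ 1)\<^sup>2 + b * (x $ 1) * (x $ 2) + c * (x $ 2)\<^sup>2"
    assume "x \<in> {x. a * (x $ 1)\<^sup>2 + b * (x $ 1) * (x $ 2) + c * (x $ 2)\<^sup>2 < 1}"
    then have q: "4 * a * ?q \<le> 4 * a" "4 * c * ?q \<le> 4 * c"
      using assms by auto
    have "4 * a * ?q = (2 * a * x $ 1 + b * x $ 2)\<^sup>2 + D * (x $ 2)\<^sup>2"
      and "4 * c * ?q = (2 * c * x $ 2 + b * x $ 1)\<^sup>2 + D * (x $ 1)\<^sup>2"
      by (simp_all add: D_def power2_eq_square algebra_simps)
    with q have "D * (x $ 2)\<^sup>2 \<le> 4 * a" "D * (x $ 1)\<^sup>2 \<le> 4 * c"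
      by (smt (verit) zero_le_power2)+
    with le assms have "\<bar>x $ 2\<bar> \<le> 4 * a / D + 1" "\<bar>x $ 1\<bar> \<le> 4 * c / D + 1"
      by auto
    moreover have "norm x \<le> \<bar>x $ 1\<bar> + \<bar>x $ 2\<bar>"
      using norm_le_l1_cart[of x] by (simp add: sum_2)
    ultimately show "norm x \<le> (4 * a / D + 1) + (4 * c / D + 1)" by linarith
  qed
qed

theorem theorem2p1:
  fixes a b c :: real and \<Omega> :: "(real^2) set"
  assumes "a > 0" and "c > 0" and "b^2 - 4 * a * c < 0"
    and "\<Omega> = {x. a * (x $ 1)^2 + b * (x $ 1) * (x $ 2) + c * (x $ 2)^2 < 1}"
  shows "solves_Z11_equation \<Omega> (\<lambda>x. 1 + c / a)"
proof -
  define q where "q x = a * (x $ 1)\<^sup>2 + b * (x $ 1) * (x $ 2) + c * (x $ 2)\<^sup>2" for x :: "real^2"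
  \<comment> \<open>The value 0 off \<open>\<Omega>\<close> follows the convention of
    \<open>dirichlet_solution\<close>. Below, \<open>\<psi>1\<close> and \<open>\<psi>2\<close> form
    the gradient of the quadratic branch.\<close>
  define \<psi> where "\<psi> x = (if x \<in> \<Omega> then (q x - 1) / (2 * a) else 0)" for x
  define \<psi>1 where "\<psi>1 x = (2 * a * x $ 1 + b * x $ 2) / (2 * a)" for x :: "real^2"
  define \<psi>2 where "\<psi>2 x = (b * x $ 1 + 2 * c * x $ 2) / (2 * a)" for x :: "real^2"
  have \<Omega>: "\<Omega> = {x. q x < 1}" using assms(4) by (simp add: q_def)
  have q_cont: "continuous_on A q" for A
    unfolding q_def by (intro continuous_intros)
  have "open \<Omega>"
    unfolding \<Omega> by (intro open_Collect_less q_cont continuous_intros)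
  have "bounded \<Omega>"
    using ellipse_bounded assms by simp
  have "closed {x. q x \<le> 1}"
    by (intro closed_Collect_le q_cont continuous_intros)
  then have cl: "closure \<Omega> \<subseteq> {x. q x \<le> 1}"
    by (intro closure_minimal) (auto simp: \<Omega>)
  \<comment> \<open>A point of the closure outside \<open>\<Omega>\<close> has
    \<open>q x = 1\<close>, so the two branches agree there; continuity up to the boundary
    follows.\<close>
  have \<psi>_closure: "\<psi> x = (q x - 1) / (2 * a)" if "x \<in> closure \<Omega>" for x
    using that cl by (auto simp: \<psi>_def \<Omega>)

  have \<psi>_deriv: "(\<psi> has_derivative (\<lambda>h. \<psi>1 x * h $ 1 + \<psi>2 x * h $ 2)) (at x)" if "x \<in> \<Omega>" for x
  proof (rule has_derivative_agree_on_open[OF _ \<open>open \<Omega>\<close> that])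
    show "((\<lambda>x. (q x - 1) / (2 * a)) has_derivative (\<lambda>h. \<psi>1 x * h $ 1 + \<psi>2 x * h $ 2)) (at x)"
      unfolding q_def \<psi>1_def \<psi>2_def using \<open>a > 0\<close>
      by (auto intro!: derivative_eq_intros has_derivative_vec_nth simp: field_simps)
  qed (simp add: \<psi>_def)
  have pd: "partial_deriv 1 \<psi> x = \<psi>1 x" "partial_deriv 2 \<psi> x = \<psi>2 x" if "x \<in> \<Omega>" for x
    using partial_deriv_eq[OF \<psi>_deriv[OF that]] by (simp_all add: axis_def)
  have \<psi>1_deriv: "(partial_deriv 1 \<psi> has_derivative (\<lambda>h. h $ 1 + b / (2 * a) * h $ 2)) (at x)"
    if "x \<in> \<Omega>" for x
  proof (rule has_derivative_agree_on_open[OF _ \<open>open \<Omega>\<close> that])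
    show "(\<psi>1 has_derivative (\<lambda>h. h $ 1 + b / (2 * a) * h $ 2)) (at x)"
      unfolding \<psi>1_def using \<open>a > 0\<close>
      by (auto intro!: derivative_eq_intros has_derivative_vec_nth simp: field_simps)
  qed (rule pd)
  have \<psi>2_deriv: "(partial_deriv 2 \<psi> has_derivative (\<lambda>h. b / (2 * a) * h $ 1 + c / a * h $ 2)) (at x)"
    if "x \<in> \<Omega>" for x
  proof (rule has_derivative_agree_on_open[OF _ \<open>open \<Omega>\<close> that])
    show "(\<psi>2 has_derivative (\<lambda>h. b / (2 * a) * h $ 1 + c / a * h $ 2)) (at x)"
      unfolding \<psi>2_def using \<open>a > 0\<close>
      by (auto intro!: derivative_eq_intros has_derivative_vec_nth simp: field_simps)
  qed (rule pd)
  have pdd: "partial_deriv 1 (partial_deriv 1 \<psi>) x = 1"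
      "partial_deriv 2 (partial_deriv 1 \<psi>) x = b / (2 * a)"
      "partial_deriv 1 (partial_deriv 2 \<psi>) x = b / (2 * a)"
      "partial_deriv 2 (partial_deriv 2 \<psi>) x = c / a" if "x \<in> \<Omega>" for x
    using partial_deriv_eq[OF \<psi>1_deriv[OF that]] partial_deriv_eq[OF \<psi>2_deriv[OF that]]
    by (simp_all add: axis_def)

  have pd_diff: "partial_deriv i \<psi> differentiable (at x)" if "x \<in> \<Omega>" for i x
    using exhaust_2[of i] differentiableI[OF \<psi>1_deriv[OF that]] differentiableI[OF \<psi>2_deriv[OF that]]
    by auto
  have "C1_on \<Omega> \<psi>"
    unfolding C1_on_def
  proof (intro conjI ballI allI)
    show "\<psi> differentiable (at x)" if "x \<in> \<Omega>" for x
      using \<psi>_deriv[OF that] by (rule differentiableI)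
    show "continuous_on \<Omega> (partial_deriv i \<psi>)" for i
      using pd_diff by (simp add: continuous_at_imp_continuous_on differentiable_imp_continuous_within)
  qed
  \<comment> \<open>The second partials are constant on \<open>\<Omega>\<close>, hence continuous
    there.\<close>
  moreover have "C1_on \<Omega> (partial_deriv i \<psi>)" for i
    using exhaust_2[of i] pd_diff
    by (auto simp: C1_on_def forall_2 pdd cong: continuous_on_cong)
  ultimately have "C2_on \<Omega> \<psi>"
    by (simp add: C2_on_def)
  moreover have "continuous_on (closure \<Omega>) \<psi>"
  proof (subst continuous_on_cong[OF refl \<psi>_closure])
    show "continuous_on (closure \<Omega>) (\<lambda>x. (q x - 1) / (2 * a))"
      using \<open>a > 0\<close> by (intro continuous_intros q_cont) auto
  qed
  moreover have "laplacian \<psi> x = 1 + c / a" if "x \<in> \<Omega>" for x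
    using that by (simp add: laplacian_def sum_2 pdd)
  moreover have "\<psi> x = 0" if "x \<in> frontier \<Omega> \<or> x \<notin> closure \<Omega>" for x
    using that \<open>open \<Omega>\<close> closure_subset by (auto simp: \<psi>_def frontier_def interior_open)
  ultimately have sol: "dirichlet_solution \<Omega> (\<lambda>x. 1 + c / a) \<psi>"
    by (simp add: dirichlet_solution_def)
  then have ex1: "\<exists>!\<psi>. dirichlet_solution \<Omega> (\<lambda>x. 1 + c / a) \<psi>"
    using dirichlet_solution_unique[OF \<open>open \<Omega>\<close> \<open>bounded \<Omega>\<close>] by blast
  \<comment> \<open>Existence and uniqueness let the description operator evaluate to
    \<open>\<psi>\<close>. Its second derivative in the first variable is 1 on
    \<open>\<Omega>\<close>, so the equation reduces to \<open>1 * Q = Q\<close>.\<close>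
  then have "inv_laplacian \<Omega> (\<lambda>x. 1 + c / a) = \<psi>"
    unfolding inv_laplacian_def using sol by blast
  with ex1 show ?thesis
    by (simp add: solves_Z11_equation_def Z_op_def pdd)
qed

end
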